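(* Let $m,n\ge 0$ be integers. The function $$Y_{m,n}(x)=\frac{\Phi^{(m+n+1)}(x)}{\Phi^{(m)}(x)\,\Phi^{(n)}(x)}$$ is decreasing in $x$ from $(0,\infty)$ onto the open interval $\Bigl(-\frac{2(m+n+1)!}{m!\,n!},\,-\frac{(m+n+1)!}{m!\,n!}\Bigr)$. Consequently, for all integers $m,n\ge0$, the double inequality $$-\frac{2(m+n+1)!}{m!\,n!}<Y_{m,n}(x)<-\frac{(m+n+1)!}{m!\,n!}$$ is valid for all $x\in(0,\infty)$ and is sharp in the sense that the lower bound cannot be replaced by any larger number and the upper bound cannot be replaced by any smaller number.
   Context: $\Gamma(x)=\int_0^\infty t^{x-1}e^{-t}\,dt$ for $x>0$ is Euler's gamma function, $\psi(x)=\frac{\Gamma'(x)}{\Gamma(x)}$ is the digamma function, and $\psi'$ is the trigamma function. Define $\Phi(x)=x\psi'(x)-1$ for $x\in(0,\infty)$; $\Phi^{(k)}$ denotes its $k$-th derivative, with $\Phi^{(0)}=\Phi$. (It is known that for every $k\ge0$ the function $(-1)^k\Phi^{(k)}$ is completely monotonic and positive on $(0,\infty)$, so the denominators do not vanish.) *)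

theory Defs
  imports "HOL-Analysis.Analysis"
begin

text \<open>
  The library's \<^const>\<open>Gamma\<close> and \<^const>\<open>Digamma\<close> are defined by limits and series. On the
  positive reals they agree with Euler's integral and with the logarithmic derivative of
  \<^const>\<open>Gamma\<close>, respectively.
\<close>

lemma Gamma_eq_Euler_integral:
  fixes x :: real
  assumes "x > 0"
  shows "((\<lambda>t. t powr (x - 1) * exp (- t)) has_integral Gamma x) {0..}"
  using Gamma_integral_real[OF assms] by (simp add: exp_minus divide_inverse)

lemma Digamma_eq_deriv_Gamma:
  fixes x :: real
  assumes "x > 0"
  shows "Digamma x = deriv Gamma x / Gamma x"
proof -
  have "x \<notin> \<int>\<^sub>\<le>\<^sub>0" using assms by (auto elim!: nonpos_Ints_cases)
  then have "(Gamma has_field_derivative (Gamma x * Digamma x)) (at x)"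
    by (rule has_field_derivative_Gamma)
  then have "deriv Gamma x = Gamma x * Digamma x" by (rule DERIV_imp_deriv)
  moreover have "Gamma x > 0" using assms by (rule Gamma_real_pos)
  ultimately show ?thesis by simp
qed

definition Phi :: "real \<Rightarrow> real" where
  "Phi x = x * deriv Digamma x - 1"

definition Y :: "nat \<Rightarrow> nat \<Rightarrow> real \<Rightarrow> real" where
  "Y m n x = (deriv ^^ (m + n + 1)) Phi x / ((deriv ^^ m) Phi x * (deriv ^^ n) Phi x)"

end

theory Submission
  imports Defs "HOL-Probability.Distributions" "HOL-Real_Asymp.Real_Asymp"
begin

text \<open>
  Integrating the Laplace representation of the trigamma function by parts gives
  \<open>(-1)^k \<Phi>^(k)(x) = M_k(x) = \<integral>_0^\<infinity> t^k g(t) e^(-xt) dt\<close> with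
  \<open>g(t) = (t / (1 - e^(-t)))'\<close>, so that \<open>Y_(m,n) = - M_(m+n+1) / (M_m M_n)\<close>. The weight \<open>g\<close> tends to
  \<open>1/2\<close> at \<open>0\<close> and to \<open>1\<close> at \<open>\<infinity>\<close>, which yields the limits of \<open>Y_(m,n)\<close> at \<open>\<infinity>\<close> and \<open>0\<close>. It is strictly log-concave:
  \<open>l = g'/g\<close> is strictly decreasing. Integration by parts gives
  \<open>x M_(k+1) = (k+1) M_k + \<integral> t^(k+1) g l e^(-xt) dt\<close>, and Chebyshev's integral inequality applied to
  the oppositely ordered functions \<open>t\<close> and \<open>l\<close> then shows that \<open>M_(k+1) / ((k+1) M_k)\<close> strictly
  decreases in \<open>k\<close>. Weighting this with \<open>m+n+2 = (m+1) + (n+1)\<close> makes the logarithmic derivative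
  \<open>M_(m+1)/M_m + M_(n+1)/M_n - M_(m+n+2)/M_(m+n+1)\<close> of \<open>-Y_(m,n)\<close> positive.
\<close>

section \<open>Elementary exponential inequalities; the weight and its logarithmic
  derivative\<close>

text \<open>Serves the exponential inequalities below, which are proved by repeated differentiation:
  each function vanishes at 0 and has a derivative already known to be positive. The quantified
  conclusion lets \<open>rule\<close> read off \<open>f\<close> by pattern unification.\<close>

lemma pos_if_deriv_pos:
  fixes f f' :: "real \<Rightarrow> real"
  assumes "\<And>s. s > 0 \<Longrightarrow> f' s > 0"
    and "\<And>s. (f has_real_derivative f' s) (at s)" and "f 0 = 0"
  shows "\<forall>t>0. f t > 0"
proof safe
  fix t :: real assume "t > 0"
  have "f 0 < f t"
  proof (rule DERIV_pos_imp_increasing_open[OF \<open>t > 0\<close>])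
    fix s :: real assume "0 < s" "s < t"
    then show "\<exists>y. (f has_real_derivative y) (at s) \<and> 0 < y"
      using assms(1,2)[of s] by auto
  next
    show "continuous_on {0..t} f"
      by (rule DERIV_continuous_on[OF has_field_derivative_at_within[OF assms(2)]])
  qed
  then show "f t > 0" using assms by simp
qed

text \<open>The weight g of the overview, with the derivative of t / (1 - e^(-t)) worked out; the
  closed form makes measurability immediate.\<close>

definition Phi_kernel :: "real \<Rightarrow> real" where
  "Phi_kernel t = (1 - exp (-t) - t * exp (-t)) / (1 - exp (-t))\<^sup>2"

text \<open>The function l = g'/g: differentiate log g = log (1 - e^(-t) - t e^(-t)) - 2 log (1 -
  e^(-t)) and expand both fractions by e^t.\<close>

definition log_deriv_kernel :: "real \<Rightarrow> real" where
  "log_deriv_kernel t = t / (exp t - 1 - t) - 2 / (exp t - 1)"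

lemma exp_gt_add_one: "1 + t < exp t" if "t > 0" for t :: real
proof -
  have "\<forall>t>0. exp t - 1 - t > (0 :: real)"
    by (rule pos_if_deriv_pos[where f' = "\<lambda>t. exp t - 1"]) (auto intro!: derivative_eq_intros)
  then show ?thesis using that by force
qed

lemma exp_gt_quadratic: "1 + t + t\<^sup>2 / 2 < exp t" if "t > 0" for t :: real
proof -
  have "\<forall>t>0. exp t - 1 - t - t\<^sup>2 / 2 > (0 :: real)"
    by (rule pos_if_deriv_pos[where f' = "\<lambda>t. exp t - 1 - t"])
       (use exp_gt_add_one in \<open>auto intro!: derivative_eq_intros simp: algebra_simps\<close>)
  then show ?thesis using that by force
qed

lemma exp_minus_bounds:
  fixes t :: real assumes "t > 0"
  shows "exp (-t) < 1" "1 - t < exp (-t)" "exp (-t) < 1 - t + t\<^sup>2 / 2" "exp (-t) * (1 + t) < 1"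
proof -
  show "exp (-t) < 1" using assms by simp
  have 1: "\<forall>t>0. exp (-t) - 1 + t > (0 :: real)"
    by (rule pos_if_deriv_pos[where f' = "\<lambda>t. 1 - exp (-t)"]) (auto intro!: derivative_eq_intros)
  then show "1 - t < exp (-t)" using assms by force
  have "\<forall>t>0. 1 - t + t\<^sup>2 / 2 - exp (-t) > (0 :: real)"
    by (rule pos_if_deriv_pos[where f' = "\<lambda>t. exp (-t) - 1 + t"])
       (use 1 in \<open>auto intro!: derivative_eq_intros simp: algebra_simps\<close>)
  then show "exp (-t) < 1 - t + t\<^sup>2 / 2" using assms by force
  show "exp (-t) * (1 + t) < 1"
    using exp_gt_add_one[OF assms] by (simp add: exp_minus field_simps)
qed

section \<open>Strict log-concavity of the weight\<close>

lemma log_deriv_kernel_deriv_numerator_neg: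
  fixes t :: real assumes "t > 0"
  shows "(exp t - 1 - t * exp t) * (exp t - 1)\<^sup>2 + 2 * exp t * (exp t - 1 - t)\<^sup>2 < 0"
proof -
  \<comment> \<open>After multiplying by \<open>-e^(-t)\<close>, differentiate until the sign is obvious; every function
    in the chain vanishes at 0. Between 2 and 3 a factor \<open>e^t\<close> is split off.\<close>
  have 1: "\<forall>t>0. 2 * exp (-(2 * t)) + 2 - exp t * (4 - 8 * t) > (0 :: real)"
  proof (rule pos_if_deriv_pos[where f' = "\<lambda>t. - 4 * exp (-(2 * t)) + exp t * (4 + 8 * t)"])
    fix s :: real assume "s > 0"
    then have "exp s * (4 + 8 * s) > 1 * 4" by (intro mult_strict_mono) auto
    moreover have "exp (-(2 * s)) < 1" using \<open>s > 0\<close> by simp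
    ultimately show "- 4 * exp (-(2 * s)) + exp s * (4 + 8 * s) > 0" by linarith
  qed (auto intro!: derivative_eq_intros simp: algebra_simps)
  have 2: "\<forall>t>0. - exp (-(2 * t)) + 13 + 2 * t - exp t * (12 - 8 * t) > (0 :: real)"
    by (rule pos_if_deriv_pos[where f' = "\<lambda>t. 2 * exp (-(2 * t)) + 2 - exp t * (4 - 8 * t)"])
       (rule 1[rule_format], assumption, auto intro!: derivative_eq_intros simp: algebra_simps)
  have 3: "exp t * (13 + 2 * t) - exp (-t) - exp (2 * t) * (12 - 8 * t) > 0" if "t > 0" for t :: real
  proof -
    have "exp t * (- exp (-(2 * t)) + 13 + 2 * t - exp t * (12 - 8 * t)) > 0"
      using 2 that by (intro mult_pos_pos) auto
    also have "exp t * (- exp (-(2 * t)) + 13 + 2 * t - exp t * (12 - 8 * t)) =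
        exp t * (13 + 2 * t) - exp (t + -(2 * t)) - exp (t + t) * (12 - 8 * t)"
      by (simp only: exp_add) (simp add: algebra_simps)
    finally show ?thesis by simp
  qed
  have 4: "\<forall>t>0. exp (-t) - 4 + exp t * (11 + 2 * t) - exp (2 * t) * (8 - 4 * t) > (0 :: real)"
    by (rule pos_if_deriv_pos[where f' = "\<lambda>t. exp t * (13 + 2 * t) - exp (-t) - exp (2 * t) * (12 - 8 * t)"])
       (rule 3, assumption, auto intro!: derivative_eq_intros simp: algebra_simps)
  have 5: "\<forall>t>0. exp t * (9 + 2 * t) - exp (-t) - 3 - 4 * t - exp (2 * t) * (5 - 2 * t) > (0 :: real)"
    by (rule pos_if_deriv_pos[where f' = "\<lambda>t. exp (-t) - 4 + exp t * (11 + 2 * t) - exp (2 * t) * (8 - 4 * t)"])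
       (rule 4[rule_format], assumption, auto intro!: derivative_eq_intros simp: algebra_simps)
  have 6: "\<forall>t>0. exp (-t) - (5 + 3 * t + 2 * t\<^sup>2) + exp t * (7 + 2 * t) - exp (2 * t) * (3 - t) > (0 :: real)"
    by (rule pos_if_deriv_pos[where f' = "\<lambda>t. exp t * (9 + 2 * t) - exp (-t) - 3 - 4 * t - exp (2 * t) * (5 - 2 * t)"])
       (rule 5[rule_format], assumption, auto intro!: derivative_eq_intros simp: algebra_simps)
  have "exp t * (exp (-t) - (5 + 3 * t + 2 * t\<^sup>2) + exp t * (7 + 2 * t) - exp (2 * t) * (3 - t)) > 0"
    using 6 assms by (intro mult_pos_pos) auto
  moreover have "exp (-t) = inverse (exp t)" "exp (2 * t) = (exp t)\<^sup>2"
    by (simp_all add: exp_minus exp_double)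
  ultimately have 7: "exp t * (inverse (exp t) - (5 + 3 * t + 2 * t\<^sup>2) + exp t * (7 + 2 * t) - (exp t)\<^sup>2 * (3 - t)) > 0"
    by simp
  \<comment> \<open>With exp t replaced by an indeterminate E subject only to E * inverse E = 1, the
    comparison becomes an identity that \<open>algebra\<close> can decide.\<close>
  define E where "E = exp t"
  have "E * inverse E = 1" by (simp add: E_def)
  then have "(E - 1 - t * E) * (E - 1)\<^sup>2 + 2 * E * (E - 1 - t)\<^sup>2 =
      - (E * (inverse E - (5 + 3 * t + 2 * t\<^sup>2) + E * (7 + 2 * t) - E\<^sup>2 * (3 - t)))"
    by algebra
  with 7 show ?thesis unfolding E_def by linarith
qed

text \<open>Over the common denominator A^2 B^2 the derivative has exactly the numerator treated in
  \<open>log_deriv_kernel_deriv_numerator_neg\<close>, because A - r B = e^r - 1 - r e^r.\<close>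

lemma log_deriv_kernel_strict_antimono:
  assumes "0 < s" "s < t"
  shows "log_deriv_kernel t < log_deriv_kernel s"
proof (rule DERIV_neg_imp_decreasing[OF \<open>s < t\<close>])
  fix r :: real assume "s \<le> r"
  then have "r > 0" using assms by simp
  define A where "A = exp r - 1 - r"
  define B where "B = exp r - 1"
  have AB: "A > 0" "B > 0" using exp_gt_add_one[OF \<open>r > 0\<close>] \<open>r > 0\<close> by (auto simp: A_def B_def)
  have "(log_deriv_kernel has_real_derivative
      (A - r * B) / A\<^sup>2 + 2 * exp r / B\<^sup>2) (at r)"
    unfolding log_deriv_kernel_def using AB
    by (auto intro!: derivative_eq_intros simp: A_def B_def power2_eq_square)
  moreover have "(A - r * B) / A\<^sup>2 + 2 * exp r / B\<^sup>2 = ((A - r * B) * B\<^sup>2 + 2 * exp r * A\<^sup>2) / (A\<^sup>2 * B\<^sup>2)"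
    using AB by (simp add: add_frac_eq)
  moreover have "(A - r * B) * B\<^sup>2 + 2 * exp r * A\<^sup>2 < 0"
    using log_deriv_kernel_deriv_numerator_neg[OF \<open>r > 0\<close>] by (simp add: A_def B_def algebra_simps)
  ultimately show "\<exists>y. (log_deriv_kernel has_real_derivative y) (at r) \<and> y < 0"
    using AB by (intro exI[of _ "((A - r * B) * B\<^sup>2 + 2 * exp r * A\<^sup>2) / (A\<^sup>2 * B\<^sup>2)"]) (simp add: divide_neg_pos)
qed

text \<open>Both summands of t * l lie in [0, 2], by e^t - 1 - t > t^2 / 2 and e^t - 1 > t, so the
  cancellation of their poles in l at 0 need not be studied. The bound dominates the integrals that
  contain l.\<close>

lemma mult_log_deriv_kernel_bound:
  assumes "t > 0" shows "\<bar>t * log_deriv_kernel t\<bar> \<le> 2"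
proof -
  define a where "a = t\<^sup>2 / (exp t - 1 - t)"
  define b where "b = 2 * (t / (exp t - 1))"
  have "0 \<le> a" "a \<le> 2" "0 \<le> b" "b \<le> 2"
    using exp_gt_quadratic[OF assms] exp_gt_add_one[OF assms] assms
    by (auto simp: a_def b_def divide_simps)
  moreover have "t * log_deriv_kernel t = a - b"
    by (simp add: a_def b_def log_deriv_kernel_def power2_eq_square right_diff_distrib)
  ultimately show ?thesis by linarith
qed

section \<open>Derivative, antiderivative and bounds of the weight\<close>

text \<open>With q = e^(-t) the weight is A / B^2, where A' = t q and B' = q. Hence g'/g = t q / A -
  2 q / B, and e^t = 1 / q turns this into \<open>log_deriv_kernel\<close>.\<close>

lemma DERIV_Phi_kernel:
  assumes "t > 0"
  shows "(Phi_kernel has_real_derivative Phi_kernel t * log_deriv_kernel t) (at t)"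
proof -
  define q where "q = exp (-t)"
  define A where "A = 1 - q - t * q"
  define B where "B = 1 - q"
  have AB: "A > 0" "B > 0"
    using exp_minus_bounds[OF assms] by (auto simp: A_def B_def q_def algebra_simps)
  have "q > 0" by (simp add: q_def)
  have e: "exp t = 1 / q" by (simp add: q_def exp_minus field_simps)
  have l: "log_deriv_kernel t = t * q / A - 2 * q / B"
  proof -
    have "exp t - 1 - t = A / q" "exp t - 1 = B / q"
      using \<open>q > 0\<close> by (auto simp: e A_def B_def field_simps)
    then show ?thesis unfolding log_deriv_kernel_def by simp
  qed
  have num: "((\<lambda>t. 1 - exp (-t) - t * exp (-t)) has_real_derivative t * q) (at t)"
    by (auto intro!: derivative_eq_intros simp: q_def)
  have den: "((\<lambda>t. (1 - exp (-t))\<^sup>2) has_real_derivative 2 * B * q) (at t)"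
    by (auto intro!: derivative_eq_intros simp: q_def B_def)
  have "(Phi_kernel has_real_derivative (t * q * B\<^sup>2 - A * (2 * B * q)) / (B\<^sup>2 * B\<^sup>2)) (at t)"
    using DERIV_divide[OF num den] AB
    by (simp add: Phi_kernel_def[abs_def] A_def B_def q_def)
  also have "(t * q * B\<^sup>2 - A * (2 * B * q)) / (B\<^sup>2 * B\<^sup>2) = Phi_kernel t * log_deriv_kernel t"
  proof -
    have "Phi_kernel t = A / B\<^sup>2" by (simp add: Phi_kernel_def A_def B_def q_def)
    then show ?thesis using AB by (simp add: l field_simps power2_eq_square)
  qed
  finally show ?thesis .
qed

lemma DERIV_Phi_kernel_antideriv:
  assumes "t > 0"
  shows "((\<lambda>t. t / (1 - exp (-t))) has_real_derivative Phi_kernel t) (at t)"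
proof -
  have "1 - exp (-t) \<noteq> 0" using assms by simp
  then have "((\<lambda>t. t / (1 - exp (-t))) has_real_derivative
      (1 * (1 - exp (-t)) - t * exp (-t)) / ((1 - exp (-t)) * (1 - exp (-t)))) (at t)"
    by (intro DERIV_divide) (auto intro!: derivative_eq_intros)
  then show ?thesis by (simp add: Phi_kernel_def power2_eq_square)
qed

text \<open>The first two bounds give integrability. The third measures how fast g approaches 1/2 at
  0, which governs the moments for large x; the fourth how fast it approaches 1 at infinity, which
  governs them as x tends to 0.\<close>

lemma Phi_kernel_bounds:
  assumes "t > 0"
  shows "1 / 2 \<le> Phi_kernel t" "Phi_kernel t \<le> 1" "Phi_kernel t - 1 / 2 \<le> t / 2"
    "1 - Phi_kernel t \<le> (1 + t)\<^sup>2 * exp (-t) / 2"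
proof -
  define q where "q = exp (-t)"
  have q: "0 < q" "q < 1" "1 - t < q" "q < 1 - t + t\<^sup>2 / 2" "q * (1 + t) < 1"
    using exp_minus_bounds[OF assms] by (auto simp: q_def)
  have k: "Phi_kernel t = (1 - q - t * q) / (1 - q)\<^sup>2" by (simp add: Phi_kernel_def q_def)
  have sq: "(1 - q)\<^sup>2 > 0" using q by simp
  have q2: "exp (-(2 * t)) = q\<^sup>2" by (simp add: q_def flip: exp_double)
  \<comment> \<open>The left side is 2 e^(-t) (sinh t - t), and it is the numerator of g - 1/2 in
    \<open>half\<close>.\<close>
  have "\<forall>t>0. 1 - exp (-(2 * t)) - 2 * t * exp (-t) > (0 :: real)"
  proof (rule pos_if_deriv_pos[where f' = "\<lambda>t. 2 * exp (-t) * (exp (-t) - 1 + t)"])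
    show "2 * exp (- s) * (exp (- s) - 1 + s) > 0" if "s > 0" for s :: real
      using exp_minus_bounds(2)[OF that] by (intro mult_pos_pos) auto
    show "((\<lambda>t. 1 - exp (-(2 * t)) - 2 * t * exp (-t)) has_real_derivative
            2 * exp (- s) * (exp (- s) - 1 + s)) (at s)" for s :: real
    proof -
      have "exp (-(2 * s)) = exp (-s) * exp (-s)" by (simp flip: exp_add)
      then show ?thesis by (auto intro!: derivative_eq_intros simp: algebra_simps)
    qed
  qed auto
  then have 1: "1 - q\<^sup>2 - 2 * t * q > 0" using assms q2 by (auto simp: q_def)
  have mult: "Phi_kernel t * (1 - q)\<^sup>2 = 1 - q - t * q" unfolding k using q by simp
  have half: "Phi_kernel t - 1 / 2 = (1 - q\<^sup>2 - 2 * t * q) / (2 * (1 - q)\<^sup>2)"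
  proof -
    have "(Phi_kernel t - 1 / 2) * (2 * (1 - q)\<^sup>2) = 2 * (Phi_kernel t * (1 - q)\<^sup>2) - (1 - q)\<^sup>2"
      by (simp add: algebra_simps)
    also have "\<dots> = 1 - q\<^sup>2 - 2 * t * q" unfolding mult by (simp add: power2_eq_square algebra_simps)
    finally show ?thesis using q by (simp add: eq_divide_eq)
  qed
  have "Phi_kernel t - 1 / 2 \<ge> 0" unfolding half using 1 by simp
  then show "1 / 2 \<le> Phi_kernel t" by simp
  \<comment> \<open>The left side is 2 e^(-t) (t cosh t - sinh t). Its positivity is what remains of
    g - 1/2 < t/2 after clearing denominators.\<close>
  have "\<forall>t>0. t * (1 + exp (-(2 * t))) - 1 + exp (-(2 * t)) > (0 :: real)"
  proof (rule pos_if_deriv_pos[where f' = "\<lambda>t. 1 - exp (-(2 * t)) * (1 + 2 * t)"])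
    show "1 - exp (-(2 * s)) * (1 + 2 * s) > 0" if "s > 0" for s :: real
      using exp_minus_bounds(4)[of "2 * s"] that by auto
  qed (auto intro!: derivative_eq_intros simp: algebra_simps)
  then have 2: "t * (1 + q\<^sup>2) - 1 + q\<^sup>2 > 0" using assms unfolding q2[symmetric] by blast
  have "Phi_kernel t - 1 / 2 = (1 - q\<^sup>2 - 2 * t * q) / (2 * (1 - q)\<^sup>2)" by (fact half)
  also have "\<dots> \<le> (t * (1 - q)\<^sup>2) / (2 * (1 - q)\<^sup>2)"
    using 2 sq by (intro divide_right_mono) (auto simp: power2_eq_square algebra_simps)
  finally show "Phi_kernel t - 1 / 2 \<le> t / 2" using sq by simp
  have eq: "1 - Phi_kernel t = q * (t - 1 + q) / (1 - q)\<^sup>2"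
  proof -
    have "(1 - Phi_kernel t) * (1 - q)\<^sup>2 = (1 - q)\<^sup>2 - Phi_kernel t * (1 - q)\<^sup>2"
      by (simp add: algebra_simps)
    also have "\<dots> = q * (t - 1 + q)" unfolding mult by (simp add: power2_eq_square algebra_simps)
    finally show ?thesis using q by (simp add: eq_divide_eq)
  qed
  have "1 - Phi_kernel t \<ge> 0" unfolding eq using q by (intro divide_nonneg_nonneg mult_nonneg_nonneg) auto
  then show "Phi_kernel t \<le> 1" by simp
  \<comment> \<open>A rearrangement of q (1 + t) < 1. Squared, it lets the factor t^2 from t - 1 + q
    < t^2 / 2 absorb the denominator (1 - q)^2.\<close>
  have "t \<le> (1 - q) * (1 + t)" using q by (simp add: algebra_simps)
  then have 3: "t\<^sup>2 \<le> (1 - q)\<^sup>2 * (1 + t)\<^sup>2"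
    using assms by (metis power_mono power_mult_distrib less_imp_le)
  have "q * (t - 1 + q) \<le> q * (t\<^sup>2 / 2)" using q by (intro mult_left_mono) auto
  also have "\<dots> \<le> q * ((1 - q)\<^sup>2 * (1 + t)\<^sup>2 / 2)" using q 3 by (intro mult_left_mono) auto
  finally have "1 - Phi_kernel t \<le> q * ((1 - q)\<^sup>2 * (1 + t)\<^sup>2 / 2) / (1 - q)\<^sup>2"
    unfolding eq using sq by (intro divide_right_mono) auto
  also have "\<dots> = (1 + t)\<^sup>2 * exp (-t) / 2" using sq by (simp add: q_def)
  finally show "1 - Phi_kernel t \<le> (1 + t)\<^sup>2 * exp (-t) / 2" .
qed

section \<open>Integration over the positive half-line\<close>

text \<open>Restricting the measure instead of inserting indicators keeps the integrands bare.
  Leaving out 0 means that pointwise facts are needed only for t > 0, where no denominator of the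
  weight vanishes.\<close>

abbreviation half_line :: "real measure" where
  "half_line \<equiv> restrict_space lborel {0<..}"

lemma borel_measurable_half_line [intro]:
  "f \<in> borel_measurable borel \<Longrightarrow> f \<in> borel_measurable half_line"
  by (rule measurable_restrict_space1) simp

text \<open>The integrand is k! / x^(k+1) times the Erlang density, whose total mass (zeroth moment)
  is 1.\<close>

lemma has_bochner_integral_power_exp:
  assumes "x > 0"
  shows "has_bochner_integral half_line (\<lambda>t. t ^ k * exp (-(x * t))) (fact k / x ^ Suc k)"
proof (rule has_bochner_integral_nn_integral)
  have "(\<integral>\<^sup>+ t. ennreal (t ^ k * exp (-(x * t))) \<partial>half_line) =
      (\<integral>\<^sup>+ t. ennreal (t ^ k * exp (-(x * t))) * indicator {0<..} t \<partial>lborel)"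
    by (rule nn_integral_restrict_space) simp
  also have "\<dots> = (\<integral>\<^sup>+ t. ennreal (fact k / x ^ Suc k) * ennreal (erlang_density k x t * t ^ 0) \<partial>lborel)"
  proof (rule nn_integral_cong_AE)
    \<comment> \<open>The Erlang density includes the origin, so for k = 0 the two sides differ at t
      = 0.\<close>
    have "AE t::real in lborel. t \<noteq> 0" by (rule AE_lborel_singleton)
    then show "AE t in lborel. ennreal (t ^ k * exp (-(x * t))) * indicator {0<..} t =
        ennreal (fact k / x ^ Suc k) * ennreal (erlang_density k x t * t ^ 0)"
      by eventually_elim
         (use assms in \<open>auto simp: erlang_density_def indicator_def simp flip: ennreal_mult\<close>)
  qed
  also have "\<dots> = ennreal (fact k / x ^ Suc k)"
    using assms by (simp add: nn_integral_cmult nn_integral_erlang_ith_moment[of x k 0, simplified])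
  finally show "(\<integral>\<^sup>+ t. ennreal (t ^ k * exp (-(x * t))) \<partial>half_line) = ennreal (fact k / x ^ Suc k)" .
  show "AE t in half_line. 0 \<le> t ^ k * exp (-(x * t))"
    by (rule AE_I2) (auto simp: space_restrict_space)
qed (use assms in auto)

text \<open>Every integration by parts below uses this with \<open>F\<close> the product being
  differentiated and \<open>a\<close>, \<open>b\<close> its boundary limits.\<close>

lemma integral_half_line_FTC:
  fixes F f :: "real \<Rightarrow> real"
  assumes "\<And>t. t > 0 \<Longrightarrow> (F has_real_derivative f t) (at t)"
    and "\<And>t. t > 0 \<Longrightarrow> isCont f t"
    and "integrable half_line f"
    and "(F \<longlongrightarrow> a) (at_right 0)" "(F \<longlongrightarrow> b) at_top"
  shows "(LINT t|half_line. f t) = b - a"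
proof -
  have ei: "einterval 0 \<infinity> = {0<..}" by (auto simp: einterval_def)
  have "(LBINT t=0..\<infinity>. f t) = b - a"
  proof (rule interval_integral_FTC_integrable)
    show "set_integrable lborel (einterval 0 \<infinity>) f"
      using assms(3) by (simp add: ei set_integrable_def integrable_restrict_space)
    show "((F \<circ> real_of_ereal) \<longlongrightarrow> a) (at_right 0)"
      using assms(4) ereal_tendsto_simps1(2)[of F a 0] by (simp add: zero_ereal_def)
    show "((F \<circ> real_of_ereal) \<longlongrightarrow> b) (at_left \<infinity>)"
      using assms(5) by (simp add: ereal_tendsto_simps)
  qed (use assms(1,2) in \<open>auto simp: has_real_derivative_iff_has_vector_derivative\<close>)
  then show ?thesis
    by (simp add: interval_lebesgue_integral_def ei set_lebesgue_integral_def integral_restrict_space)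
qed

text \<open>A zero integral would force f = 0 almost everywhere and make the half-line, up to the
  point c, a null set. The exceptional point c is needed for the Chebyshev argument, whose integrand
  vanishes there.\<close>

lemma integral_half_line_pos:
  fixes f :: "real \<Rightarrow> real"
  assumes f: "integrable half_line f" and pos: "\<And>t. t > 0 \<Longrightarrow> t \<noteq> c \<Longrightarrow> f t > 0" and "f c \<ge> 0"
  shows "(LINT t|half_line. f t) > 0"
proof -
  have ge: "AE t in half_line. f t \<ge> 0"
  proof (rule AE_I2)
    fix t assume "t \<in> space half_line"
    then show "f t \<ge> 0" using pos[of t] \<open>f c \<ge> 0\<close> by (cases "t = c") (auto simp: space_restrict_space)
  qed
  have "(LINT t|half_line. f t) \<noteq> 0"
  proof
    assume "(LINT t|half_line. f t) = 0"
    then have "AE t in half_line. f t = 0"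
      using integral_nonneg_eq_0_iff_AE[OF f ge] by blast
    then have "AE t in lborel. t > 0 \<longrightarrow> f t = 0"
      by (subst (asm) AE_restrict_space_iff) auto
    moreover have "AE t in lborel. t \<noteq> c" by (rule AE_lborel_singleton)
    ultimately have "AE t::real in lborel. t \<notin> {0<..}"
      by eventually_elim (use pos in force)
    then have "{0<..} \<in> null_sets (lborel :: real measure)"
      by (simp add: AE_iff_null_sets)
    then have "{0<..1} \<in> null_sets (lborel :: real measure)"
      by (rule null_sets_subset) auto
    then show False by (simp add: null_sets_def)
  qed
  moreover have "(LINT t|half_line. f t) \<ge> 0" by (rule integral_nonneg_AE[OF ge])
  ultimately show ?thesis by simp
qed

lemma borel_measurable_Phi_kernel [measurable]: "Phi_kernel \<in> borel_measurable borel"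
  unfolding Phi_kernel_def[abs_def] by measurable

lemma borel_measurable_log_deriv_kernel [measurable]: "log_deriv_kernel \<in> borel_measurable borel"
  unfolding log_deriv_kernel_def[abs_def] by measurable

section \<open>Moments of the weight and their limits\<close>

text \<open>M_k of the overview; \<open>higher_deriv_Phi\<close> relates it to the derivatives of
  \<open>Phi\<close>.\<close>

definition moment :: "nat \<Rightarrow> real \<Rightarrow> real" where
  "moment k x = (LINT t|half_line. t ^ k * Phi_kernel t * exp (-(x * t)))"

lemma integrable_power_exp:
  "x > 0 \<Longrightarrow> integrable half_line (\<lambda>t. t ^ k * exp (-(x * t)))"
  using has_bochner_integral_power_exp has_bochner_integral_iff by blast

lemma integral_power_exp:
  "x > 0 \<Longrightarrow> (LINT t|half_line. t ^ k * exp (-(x * t))) = fact k / x ^ Suc k"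
  using has_bochner_integral_power_exp has_bochner_integral_iff by blast

lemma integrable_half_line_bound:
  fixes f g :: "real \<Rightarrow> real"
  assumes "integrable half_line g" "f \<in> borel_measurable borel"
    and "\<And>t. t > 0 \<Longrightarrow> \<bar>f t\<bar> \<le> g t"
  shows "integrable half_line f"
proof (rule Bochner_Integration.integrable_bound[OF assms(1)])
  show "AE t in half_line. norm (f t) \<le> norm (g t)"
    by (rule AE_I2) (use assms(3) in \<open>force simp: space_restrict_space\<close>)
qed (use assms(2) in auto)

lemma integral_half_line_mono:
  fixes f g :: "real \<Rightarrow> real"
  assumes "integrable half_line f" "integrable half_line g"
    and "\<And>t. t > 0 \<Longrightarrow> f t \<le> g t"
  shows "(LINT t|half_line. f t) \<le> (LINT t|half_line. g t)"
  by (rule integral_mono[OF assms(1,2)]) (simp add: assms(3) space_restrict_space)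

lemma integrable_moment:
  assumes "x > 0"
  shows "integrable half_line (\<lambda>t. t ^ k * Phi_kernel t * exp (-(x * t)))"
proof (rule integrable_half_line_bound[OF integrable_power_exp[OF assms, of k]])
  fix t :: real assume "t > 0"
  then show "\<bar>t ^ k * Phi_kernel t * exp (-(x * t))\<bar> \<le> t ^ k * exp (-(x * t))"
    using Phi_kernel_bounds(1,2)[OF \<open>t > 0\<close>]
    by (auto simp: abs_mult intro!: mult_right_mono mult_right_le_one_le)
qed auto

text \<open>Integrates g \<ge> 1/2. It serves twice: for positivity of the moments and for their
  limit at infinity.\<close>

lemma moment_lower_bound:
  assumes "x > 0" shows "fact k / (2 * x ^ Suc k) \<le> moment k x"
proof -
  have "(LINT t|half_line. 1 / 2 * (t ^ k * exp (-(x * t)))) \<le> moment k x"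
    unfolding moment_def
  proof (rule integral_half_line_mono)
    fix t :: real assume "t > 0"
    have "1 / 2 * (t ^ k * exp (-(x * t))) \<le> Phi_kernel t * (t ^ k * exp (-(x * t)))"
      using Phi_kernel_bounds(1) \<open>t > 0\<close> by (intro mult_right_mono) auto
    then show "1 / 2 * (t ^ k * exp (-(x * t))) \<le> t ^ k * Phi_kernel t * exp (-(x * t))"
      by (simp add: mult_ac)
  qed (intro integrable_mult_right integrable_power_exp integrable_moment assms)+
  then show ?thesis by (simp add: integral_power_exp[OF assms])
qed

lemma moment_pos: "moment k x > 0" if "x > 0"
proof -
  have "0 < fact k / (2 * x ^ Suc k)" using that by simp
  then show ?thesis using moment_lower_bound[OF that, of k] by linarith
qed

lemma moment_upper_bound:
  assumes "x > 0" shows "moment k x - fact k / (2 * x ^ Suc k) \<le> fact (Suc k) / (2 * x ^ Suc (Suc k))"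
proof -
  have "moment k x \<le> (LINT t|half_line. 1 / 2 * (t ^ k * exp (-(x * t))) + 1 / 2 * (t ^ Suc k * exp (-(x * t))))"
    unfolding moment_def
  proof (rule integral_half_line_mono)
    fix t :: real assume "t > 0"
    have "Phi_kernel t * (t ^ k * exp (-(x * t))) \<le> (1 / 2 + t / 2) * (t ^ k * exp (-(x * t)))"
      using Phi_kernel_bounds(3)[OF \<open>t > 0\<close>] \<open>t > 0\<close> by (intro mult_right_mono) auto
    then show "t ^ k * Phi_kernel t * exp (-(x * t)) \<le> 1 / 2 * (t ^ k * exp (-(x * t))) + 1 / 2 * (t ^ Suc k * exp (-(x * t)))"
      by (simp add: algebra_simps)
  qed (intro Bochner_Integration.integrable_add integrable_mult_right integrable_power_exp integrable_moment assms)+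
  also have "\<dots> = 1 / 2 * (fact k / x ^ Suc k) + 1 / 2 * (fact (Suc k) / x ^ Suc (Suc k))"
    by (subst Bochner_Integration.integral_add)
       (simp_all only: integral_mult_right_zero integral_power_exp[OF assms] integrable_mult_right integrable_power_exp[OF assms])
  finally show ?thesis by simp
qed

lemma moment_bound_near_0:
  obtains C where "\<And>x. x > 0 \<Longrightarrow> moment k x \<le> fact k / x ^ Suc k"
    "\<And>x. x > 0 \<Longrightarrow> fact k / x ^ Suc k - moment k x \<le> C"
proof
  fix x :: real assume x: "x > 0"
  show "moment k x \<le> fact k / x ^ Suc k"
    unfolding moment_def integral_power_exp[OF x, symmetric]
  proof (rule integral_half_line_mono)
    fix t :: real assume "t > 0"
    then show "t ^ k * Phi_kernel t * exp (-(x * t)) \<le> t ^ k * exp (-(x * t))"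
      using Phi_kernel_bounds(1,2)[OF \<open>t > 0\<close>]
      by (auto intro!: mult_right_mono mult_right_le_one_le)
  qed (intro integrable_power_exp integrable_moment x)+
  \<comment> \<open>This is t^k (1 + t)^2 e^(-t) / 2 expanded into monomials; the factor 1 in the
    exponents matches \<open>integrable_power_exp\<close> at x = 1.\<close>
  let ?h = "\<lambda>t::real. 1 / 2 * (t ^ k * exp (-(1 * t))) + t ^ Suc k * exp (-(1 * t)) + 1 / 2 * (t ^ Suc (Suc k) * exp (-(1 * t)))"
  have h: "integrable half_line ?h"
    by (intro Bochner_Integration.integrable_add integrable_mult_right integrable_power_exp) auto
  have "fact k / x ^ Suc k - moment k x =
      (LINT t|half_line. t ^ k * exp (-(x * t)) - t ^ k * Phi_kernel t * exp (-(x * t)))"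
    unfolding moment_def integral_power_exp[OF x, symmetric]
    by (intro Bochner_Integration.integral_diff[symmetric] integrable_power_exp integrable_moment x)
  also have "\<dots> \<le> (LINT t|half_line. ?h t)"
  proof (rule integral_half_line_mono)
    fix t :: real assume t: "t > 0"
    have "t ^ k * exp (-(x * t)) - t ^ k * Phi_kernel t * exp (-(x * t)) =
        (t ^ k * (1 - Phi_kernel t)) * exp (-(x * t))" by (simp add: algebra_simps)
    also have "\<dots> \<le> t ^ k * (1 - Phi_kernel t)"
      using t x Phi_kernel_bounds(2)[OF t] by (intro mult_right_le_one_le) auto
    also have "\<dots> \<le> t ^ k * ((1 + t)\<^sup>2 * exp (-t) / 2)"
      using t Phi_kernel_bounds(4)[OF t] by (intro mult_left_mono) auto
    also have "\<dots> = ?h t" by (simp add: algebra_simps power2_eq_square)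
    finally show "t ^ k * exp (-(x * t)) - t ^ k * Phi_kernel t * exp (-(x * t)) \<le> ?h t" .
  qed (intro Bochner_Integration.integrable_diff integrable_power_exp integrable_moment x h)+
  finally show "fact k / x ^ Suc k - moment k x \<le> (LINT t|half_line. ?h t)" .
qed

text \<open>For large x the mass of t^k e^(-xt) concentrates at 0, where g tends to 1/2; the two
  moment bounds leave an error of order 1/x.\<close>

lemma power_times_moment_tendsto_at_top: "((\<lambda>x. x ^ Suc k * moment k x) \<longlongrightarrow> fact k / 2) at_top"
proof (rule tendsto_sandwich)
  show "\<forall>\<^sub>F x in at_top. fact k / 2 \<le> x ^ Suc k * moment k x"
    using eventually_gt_at_top[of 0]
  proof eventually_elim
    case (elim x)
    then have "x ^ Suc k * (fact k / (2 * x ^ Suc k)) \<le> x ^ Suc k * moment k x"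
      by (intro mult_left_mono moment_lower_bound) auto
    then show ?case using elim by simp
  qed
  show "\<forall>\<^sub>F x in at_top. x ^ Suc k * moment k x \<le> fact k / 2 + fact (Suc k) / (2 * x)"
    using eventually_gt_at_top[of 0]
  proof eventually_elim
    case (elim x)
    then have "x ^ Suc k * moment k x \<le>
        x ^ Suc k * (fact k / (2 * x ^ Suc k) + fact (Suc k) / (2 * x ^ Suc (Suc k)))"
      using moment_upper_bound[OF elim, of k] by (intro mult_left_mono) auto
    also have "\<dots> = fact k / 2 + fact (Suc k) / (2 * x)"
      using elim by (simp add: distrib_left)
    finally show ?case .
  qed
  have "((\<lambda>x. fact k / 2 + fact (Suc k) / 2 * inverse x) \<longlongrightarrow> fact k / 2 + fact (Suc k) / 2 * 0) (at_top :: real filter)"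
    by (intro tendsto_intros tendsto_inverse_0_at_top filterlim_ident)
  then show "((\<lambda>x. fact k / 2 + fact (Suc k) / (2 * x)) \<longlongrightarrow> fact k / 2) (at_top :: real filter)"
    by (simp add: field_simps)
qed simp

text \<open>For small x the mass moves to infinity, where g tends to 1; the uniform gap C
  contributes only C x^(k+1).\<close>

lemma power_times_moment_tendsto_at_0: "((\<lambda>x. x ^ Suc k * moment k x) \<longlongrightarrow> fact k) (at_right 0)"
proof -
  obtain C where C: "\<And>x. x > 0 \<Longrightarrow> moment k x \<le> fact k / x ^ Suc k"
    "\<And>x. x > 0 \<Longrightarrow> fact k / x ^ Suc k - moment k x \<le> C" by (rule moment_bound_near_0[of k]) blast
  show ?thesis
  proof (rule tendsto_sandwich)
    show "\<forall>\<^sub>F x in at_right 0. x ^ Suc k * moment k x \<le> fact k"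
      using eventually_at_right_less[of 0]
    proof eventually_elim
      case (elim x)
      then have "x ^ Suc k * moment k x \<le> x ^ Suc k * (fact k / x ^ Suc k)"
        by (intro mult_left_mono C) auto
      then show ?case using elim by simp
    qed
    show "\<forall>\<^sub>F x in at_right 0. fact k - C * x ^ Suc k \<le> x ^ Suc k * moment k x"
      using eventually_at_right_less[of 0]
    proof eventually_elim
      case (elim x)
      then have "x ^ Suc k * (fact k / x ^ Suc k - moment k x) \<le> x ^ Suc k * C"
        by (intro mult_left_mono C) auto
      then show ?case using elim by (simp add: right_diff_distrib mult_ac)
    qed
    have "((\<lambda>x. fact k - C * x ^ Suc k) \<longlongrightarrow> fact k - C * 0 ^ Suc k) (at_right 0)"
      by (intro tendsto_intros)
    then show "((\<lambda>x. fact k - C * x ^ Suc k) \<longlongrightarrow> fact k) (at_right 0)" by simp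
  qed simp
qed

section \<open>Differentiation of the moments\<close>

text \<open>Convexity of exp suffices: the tangents at -xt and -yt place the remainder between 0 and
  d (e^(-xt) - e^(-yt)). The assumption y \<ge> x/2 supplies one decay rate for all such y.\<close>

lemma exp_minus_second_order:
  fixes t x y :: real
  assumes "t > 0" "x > 0" "y \<ge> x / 2"
  shows "\<bar>exp (-(y * t)) - exp (-(x * t)) + (y - x) * (t * exp (-(x * t)))\<bar>
      \<le> (y - x)\<^sup>2 * (t\<^sup>2 * exp (-(x / 2 * t)))"
proof -
  define d where "d = (y - x) * t"
  have tangent: "exp a * (b - a) \<le> exp b - exp a" for a b :: real
  proof -
    have "exp a * (1 + (b - a)) \<le> exp a * exp (b - a)" by (intro mult_left_mono) auto
    then show ?thesis by (simp add: exp_diff algebra_simps)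
  qed
  let ?r = "exp (-(y * t)) - exp (-(x * t)) + (y - x) * (t * exp (-(x * t)))"
  have "?r \<ge> 0" using tangent[of "-(x * t)" "-(y * t)"] by (simp add: algebra_simps)
  moreover have "?r \<le> d * (exp (-(x * t)) - exp (-(y * t)))"
    using tangent[of "-(y * t)" "-(x * t)"] by (simp add: d_def algebra_simps)
  moreover have "d * (exp (-(x * t)) - exp (-(y * t))) \<le> d\<^sup>2 * exp (-(x / 2 * t))"
  proof -
    \<comment> \<open>The same tangents enclose the difference between d e^(-yt) and d
      e^(-xt).\<close>
    have "\<bar>exp (-(x * t)) - exp (-(y * t))\<bar> \<le> \<bar>d\<bar> * exp (-(x / 2 * t))"
    proof -
      have le: "exp (-(x * t)) \<le> exp (-(x / 2 * t))" "exp (-(y * t)) \<le> exp (-(x / 2 * t))"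
        using assms by auto
      have 1: "exp (-(x * t)) - exp (-(y * t)) \<le> exp (-(x * t)) * d"
        using tangent[of "-(x * t)" "-(y * t)"] by (simp add: d_def algebra_simps)
      have 2: "exp (-(y * t)) * d \<le> exp (-(x * t)) - exp (-(y * t))"
        using tangent[of "-(y * t)" "-(x * t)"] by (simp add: d_def algebra_simps)
      have 3: "exp (-(x * t)) * \<bar>d\<bar> \<le> exp (-(x / 2 * t)) * \<bar>d\<bar>"
        "exp (-(y * t)) * \<bar>d\<bar> \<le> exp (-(x / 2 * t)) * \<bar>d\<bar>"
        using le by (intro mult_right_mono; simp)+
      have 4: "exp (-(x * t)) * d \<le> exp (-(x * t)) * \<bar>d\<bar>" "exp (-(y * t)) * (- \<bar>d\<bar>) \<le> exp (-(y * t)) * d"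
        by (intro mult_left_mono; simp)+
      show ?thesis
        using 1 2 3 4 unfolding abs_le_iff mult.commute[of "\<bar>d\<bar>"] mult_minus_right by (intro conjI) linarith+
    qed
    then have "\<bar>d\<bar> * \<bar>exp (-(x * t)) - exp (-(y * t))\<bar> \<le> \<bar>d\<bar> * (\<bar>d\<bar> * exp (-(x / 2 * t)))"
      by (intro mult_left_mono) auto
    moreover have "d * (exp (-(x * t)) - exp (-(y * t))) \<le> \<bar>d\<bar> * \<bar>exp (-(x * t)) - exp (-(y * t))\<bar>"
      by (metis abs_ge_self abs_mult)
    ultimately show ?thesis by (simp add: power2_eq_square flip: mult.assoc)
  qed
  ultimately show ?thesis by (simp add: d_def power_mult_distrib mult_ac)
qed

text \<open>Integrating \<open>exp_minus_second_order\<close> against t^k g gives a remainder of at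
  most (y - x)^2 M_(k+2)(x/2), so the difference quotient converges without a dominated convergence
  argument.\<close>

lemma DERIV_moment:
  assumes x: "x > 0"
  shows "(moment k has_real_derivative - moment (Suc k) x) (at x)"
proof -
  have bound: "\<bar>moment k y - moment k x + (y - x) * moment (Suc k) x\<bar>
      \<le> (y - x)\<^sup>2 * moment (Suc (Suc k)) (x / 2)" if y: "y \<ge> x / 2" for y
  proof -
    let ?m = "\<lambda>k x t. t ^ k * Phi_kernel t * exp (-(x * t))"
    have y0: "y > 0" "x / 2 > 0" using x y by auto
    let ?f = "\<lambda>t. ?m k y t - ?m k x t + (y - x) * ?m (Suc k) x t"
    let ?g = "\<lambda>t. (y - x)\<^sup>2 * ?m (Suc (Suc k)) (x / 2) t"
    have g: "integrable half_line ?g" by (intro integrable_mult_right integrable_moment y0)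
    have f: "integrable half_line ?f"
      by (intro integrable_mult_right integrable_moment Bochner_Integration.integrable_add
            Bochner_Integration.integrable_diff y0 x)
    have "\<bar>?f t\<bar> \<le> ?g t" if t: "t > 0" for t
    proof -
      have "?f t = t ^ k * Phi_kernel t *
          (exp (-(y * t)) - exp (-(x * t)) + (y - x) * (t * exp (-(x * t))))"
        by (simp add: algebra_simps)
      then have "\<bar>?f t\<bar> = t ^ k * Phi_kernel t *
          \<bar>exp (-(y * t)) - exp (-(x * t)) + (y - x) * (t * exp (-(x * t)))\<bar>"
        using t Phi_kernel_bounds(1)[OF t] by (simp add: abs_mult)
      also have "\<dots> \<le> t ^ k * Phi_kernel t * ((y - x)\<^sup>2 * (t\<^sup>2 * exp (-(x / 2 * t))))"
        using t Phi_kernel_bounds(1)[OF t] by (intro mult_left_mono exp_minus_second_order x y) auto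
      also have "\<dots> = ?g t" by (simp add: power2_eq_square mult_ac)
      finally show ?thesis .
    qed
    then have "(LINT t|half_line. \<bar>?f t\<bar>) \<le> (LINT t|half_line. ?g t)"
      by (intro integral_half_line_mono integrable_abs f g)
    moreover have "\<bar>LINT t|half_line. ?f t\<bar> \<le> (LINT t|half_line. \<bar>?f t\<bar>)" by (rule integral_abs_bound)
    moreover have "(LINT t|half_line. ?f t) = moment k y - moment k x + (y - x) * moment (Suc k) x"
      unfolding moment_def
      by (simp only: Bochner_Integration.integral_add Bochner_Integration.integral_diff
            Bochner_Integration.integrable_diff integral_mult_right_zero integrable_mult_right
            integrable_moment y0 x)
    moreover have "(LINT t|half_line. ?g t) = (y - x)\<^sup>2 * moment (Suc (Suc k)) (x / 2)"
      unfolding moment_def by (rule integral_mult_right_zero)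
    ultimately show ?thesis by linarith
  qed
  let ?C = "moment (Suc (Suc k)) (x / 2)"
  have "((\<lambda>y. (moment k y - moment k x) / (y - x) - (- moment (Suc k) x)) \<longlongrightarrow> 0) (at x)"
  proof (rule Lim_null_comparison)
    have "\<forall>\<^sub>F y in at x. y \<in> {x / 2<..}"
      using x by (intro eventually_at_in_open') auto
    moreover have "\<forall>\<^sub>F y in at x. y \<noteq> x" by (auto simp: eventually_at_filter)
    ultimately show "\<forall>\<^sub>F y in at x. norm ((moment k y - moment k x) / (y - x) - (- moment (Suc k) x)) \<le> \<bar>y - x\<bar> * ?C"
    proof eventually_elim
      case (elim y)
      then have "(moment k y - moment k x) / (y - x) - (- moment (Suc k) x) =
          (moment k y - moment k x + (y - x) * moment (Suc k) x) / (y - x)"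
        by (simp add: add_divide_distrib)
      then have "norm ((moment k y - moment k x) / (y - x) - (- moment (Suc k) x)) =
          \<bar>moment k y - moment k x + (y - x) * moment (Suc k) x\<bar> / \<bar>y - x\<bar>"
        by simp
      also have "\<dots> \<le> (y - x)\<^sup>2 * ?C / \<bar>y - x\<bar>"
        using elim by (intro divide_right_mono bound) auto
      also have "\<dots> = \<bar>y - x\<bar> * ?C"
      proof -
        have "(y - x)\<^sup>2 = \<bar>y - x\<bar> * \<bar>y - x\<bar>" by (simp add: power2_eq_square)
        moreover have "\<bar>y - x\<bar> \<noteq> 0" using elim by simp
        ultimately show ?thesis by (metis mult.assoc nonzero_mult_div_cancel_left)
      qed
      finally show ?case .
    qed
    have "((\<lambda>y. \<bar>y - x\<bar> * ?C) \<longlongrightarrow> \<bar>x - x\<bar> * ?C) (at x)" by (intro tendsto_intros)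
    then show "((\<lambda>y. \<bar>y - x\<bar> * ?C) \<longlongrightarrow> 0) (at x)" by simp
  qed
  then have "((\<lambda>y. (moment k y - moment k x) / (y - x)) \<longlongrightarrow> - moment (Suc k) x) (at x)"
    by (rule LIM_zero_cancel)
  then show ?thesis by (simp add: has_field_derivative_iff)
qed

section \<open>The trigamma function and the derivatives of Phi as Laplace integrals\<close>

text \<open>Expanding 1 / (1 - e^(-t)) geometrically and integrating termwise gives the sum of 1 /
  (x + i)^2, the trigamma series.\<close>

lemma has_bochner_integral_trigamma:
  fixes x :: real assumes x: "x > 0"
  shows "has_bochner_integral half_line (\<lambda>t. t / (1 - exp (-t)) * exp (-(x * t))) (deriv Digamma x)"
proof -
  have x_notin: "x \<notin> \<int>\<^sub>\<le>\<^sub>0" using x by (auto elim!: nonpos_Ints_cases)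
  define f where "f = (\<lambda>(i::nat) t. t ^ 1 * exp (-((x + real i) * t)))"
  have f_int: "has_bochner_integral half_line (f i) (inverse ((x + real i) ^ Suc 1))" for i
    unfolding f_def using has_bochner_integral_power_exp[of "x + real i" 1] x
    by (simp add: inverse_eq_divide)
  have f_sums: "(\<lambda>i. f i t) sums (t / (1 - exp (-t)) * exp (-(x * t)))" if t: "t > 0" for t
  proof -
    have "f i t = t * exp (-(x * t)) * exp (-t) ^ i" for i
    proof -
      have "-((x + real i) * t) = -(x * t) + real i * (-t)" by (simp add: algebra_simps)
      then show ?thesis by (simp only: f_def power_one_right exp_add exp_of_nat_mult mult.assoc)
    qed
    moreover have "(\<lambda>i. exp (-t) ^ i) sums (1 / (1 - exp (-t)))" using t by (intro geometric_sums) simp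
    then have "(\<lambda>i. t * exp (-(x * t)) * exp (-t) ^ i) sums (t * exp (-(x * t)) * (1 / (1 - exp (-t))))"
      by (rule sums_mult)
    ultimately show ?thesis by simp
  qed
  have tri: "(\<lambda>i. inverse ((x + real i) ^ Suc 1)) sums deriv Digamma x"
    using Polygamma_LIMSEQ[of x 1] x x_notin by (simp add: deriv_Polygamma power2_eq_square)
  have f_eq: "norm (f i t) = f i t" if "t > 0" for i t using that by (simp add: f_def)
  have 1: "integrable half_line (f i)" for i using f_int has_bochner_integral_iff by blast
  have 2: "AE t in half_line. summable (\<lambda>i. norm (f i t))"
  proof (rule AE_I2)
    fix t assume "t \<in> space half_line"
    then have t: "t > 0" by (simp add: space_restrict_space)
    then show "summable (\<lambda>i. norm (f i t))"
      using f_sums[OF t] by (simp only: f_eq[OF t] sums_iff)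
  qed
  \<comment> \<open>The terms are positive, so the integrals of their norms form the convergent
    trigamma series itself; this justifies exchanging sum and integral.\<close>
  have 3: "summable (\<lambda>i. LINT t|half_line. norm (f i t))"
  proof -
    have "(LINT t|half_line. norm (f i t)) = inverse ((x + real i) ^ Suc 1)" for i
    proof -
      have "(LINT t|half_line. norm (f i t)) = (LINT t|half_line. f i t)"
        by (rule Bochner_Integration.integral_cong[OF refl], rule f_eq) (simp add: space_restrict_space)
      also have "\<dots> = inverse ((x + real i) ^ Suc 1)" using f_int has_bochner_integral_iff by blast
      finally show ?thesis .
    qed
    then show ?thesis using tri sums_summable by simp
  qed
  have "has_bochner_integral half_line (\<lambda>t. \<Sum>i. f i t) (deriv Digamma x)"
    using integrable_suminf[OF 1 2 3] integral_suminf[OF 1 2 3] f_int tri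
    by (simp add: has_bochner_integral_iff sums_iff)
  then show ?thesis
  proof (rule has_bochner_integral_cong[THEN iffD1, rotated -1])
    fix t assume "t \<in> space half_line"
    then have "t > 0" by (simp add: space_restrict_space)
    then show "(\<Sum>i. f i t) = t / (1 - exp (-t)) * exp (-(x * t))"
      using f_sums[OF \<open>t > 0\<close>] by (simp only: sums_iff)
  qed simp_all
qed

text \<open>Integration by parts with F = t / (1 - e^(-t)) e^(-xt). Since F tends to 1 at 0 and to 0
  at infinity, the boundary term is precisely the -1 in \<open>Phi\<close>.\<close>

lemma Phi_eq_moment:
  assumes x: "x > 0" shows "Phi x = moment 0 x"
proof -
  let ?h = "\<lambda>t::real. t / (1 - exp (-t))"
  have h: "integrable half_line (\<lambda>t. ?h t * exp (-(x * t)))"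
    "(LINT t|half_line. ?h t * exp (-(x * t))) = deriv Digamma x"
    using has_bochner_integral_trigamma[OF x] has_bochner_integral_iff by blast+
  have k: "integrable half_line (\<lambda>t. Phi_kernel t * exp (-(x * t)))"
    using integrable_moment[OF x, of 0] by simp
  have cont: "isCont Phi_kernel t" "isCont ?h t" if "t > 0" for t
    using DERIV_Phi_kernel[OF that] DERIV_Phi_kernel_antideriv[OF that] DERIV_isCont by blast+
  have "(LINT t|half_line. Phi_kernel t * exp (-(x * t)) - x * (?h t * exp (-(x * t)))) = 0 - 1"
  proof (rule integral_half_line_FTC)
    show "((\<lambda>t. ?h t * exp (-(x * t))) has_real_derivative
        Phi_kernel t * exp (-(x * t)) - x * (?h t * exp (-(x * t)))) (at t)" if "t > 0" for t
      by (rule derivative_eq_intros DERIV_Phi_kernel_antideriv that refl)+ simp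
    show "isCont (\<lambda>t. Phi_kernel t * exp (-(x * t)) - x * (?h t * exp (-(x * t)))) t" if "t > 0" for t
      by (intro continuous_intros cont that)
    show "integrable half_line (\<lambda>t. Phi_kernel t * exp (-(x * t)) - x * (?h t * exp (-(x * t))))"
      by (intro Bochner_Integration.integrable_diff integrable_mult_right h k)
    show "((\<lambda>t. ?h t * exp (-(x * t))) \<longlongrightarrow> 1) (at_right 0)" by real_asymp
    show "((\<lambda>t. ?h t * exp (-(x * t))) \<longlongrightarrow> 0) at_top" using x by real_asymp
  qed
  moreover have "(LINT t|half_line. Phi_kernel t * exp (-(x * t)) - x * (?h t * exp (-(x * t)))) =
      moment 0 x - x * deriv Digamma x"
    by (subst Bochner_Integration.integral_diff)
       (simp_all only: k h integrable_mult_right integral_mult_right_zero moment_def power_0 mult_1_left)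
  ultimately show ?thesis by (simp add: Phi_def)
qed

lemma higher_deriv_Phi:
  "x > 0 \<Longrightarrow> (deriv ^^ k) Phi x = (-1) ^ k * moment k x"
proof (induction k arbitrary: x)
  case 0
  then show ?case by (simp add: Phi_eq_moment)
next
  case (Suc k)
  \<comment> \<open>The induction hypothesis holds only for positive arguments; \<open>deriv\<close>
    needs the equality on a neighbourhood of x.\<close>
  have "\<forall>\<^sub>F y in nhds x. y \<in> {0<..}" using Suc.prems by (intro eventually_nhds_in_open) auto
  then have "\<forall>\<^sub>F y in nhds x. (deriv ^^ k) Phi y = (-1) ^ k * moment k y"
    by eventually_elim (simp add: Suc.IH)
  then have "deriv ((deriv ^^ k) Phi) x = deriv (\<lambda>y. (-1) ^ k * moment k y) x"
    by (rule deriv_cong_ev) simp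
  also have "\<dots> = (-1) ^ k * (- moment (Suc k) x)"
    by (rule DERIV_imp_deriv) (intro DERIV_cmult DERIV_moment Suc.prems)
  finally show ?case by simp
qed

section \<open>Recurrence, Chebyshev's inequality and monotone moment ratios\<close>

text \<open>One factor t is spent on bounding t * l by 2, hence the exponent
  \<open>Suc k\<close>.\<close>

lemma integrable_moment_deriv:
  assumes x: "x > 0"
  shows "integrable half_line (\<lambda>t. t ^ Suc k * (Phi_kernel t * log_deriv_kernel t) * exp (-(x * t)))"
proof (rule integrable_half_line_bound)
  show "integrable half_line (\<lambda>t. 2 * (t ^ k * Phi_kernel t * exp (-(x * t))))"
    by (intro integrable_mult_right integrable_moment x)
  fix t :: real assume t: "t > 0"
  have "\<bar>t ^ Suc k * (Phi_kernel t * log_deriv_kernel t) * exp (-(x * t))\<bar> =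
      \<bar>t * log_deriv_kernel t\<bar> * (t ^ k * Phi_kernel t * exp (-(x * t)))"
    using t Phi_kernel_bounds(1)[OF t] by (simp add: abs_mult)
  also have "\<dots> \<le> 2 * (t ^ k * Phi_kernel t * exp (-(x * t)))"
    using t Phi_kernel_bounds(1)[OF t] by (intro mult_right_mono mult_log_deriv_kernel_bound) auto
  finally show "\<bar>t ^ Suc k * (Phi_kernel t * log_deriv_kernel t) * exp (-(x * t))\<bar>
      \<le> 2 * (t ^ k * Phi_kernel t * exp (-(x * t)))" .
qed measurable

text \<open>Integrates the derivative of t^(k+1) g e^(-xt). The boundary terms vanish: at 0 by the
  positive power of t, at infinity by the exponential.\<close>

lemma moment_recurrence:
  assumes x: "x > 0"
  shows "x * moment (Suc k) x = real (Suc k) * moment k x +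
    (LINT t|half_line. t ^ Suc k * (Phi_kernel t * log_deriv_kernel t) * exp (-(x * t)))"
proof -
  let ?m = "\<lambda>k t. t ^ k * Phi_kernel t * exp (-(x * t))"
  let ?d = "\<lambda>t. t ^ Suc k * (Phi_kernel t * log_deriv_kernel t) * exp (-(x * t))"
  have le: "\<bar>?m (Suc k) t\<bar> \<le> t ^ Suc k * exp (-(x * t))" if "t > 0" for t
    using that Phi_kernel_bounds(1,2)[OF that]
    by (auto simp: abs_mult intro!: mult_right_mono mult_right_le_one_le)
  have "(LINT t|half_line. real (Suc k) * ?m k t + ?d t - x * ?m (Suc k) t) = 0 - 0"
  proof (rule integral_half_line_FTC)
    show "((?m (Suc k)) has_real_derivative real (Suc k) * ?m k t + ?d t - x * ?m (Suc k) t) (at t)"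
      if "t > 0" for t
      by (rule derivative_eq_intros DERIV_Phi_kernel that refl)+ (simp add: algebra_simps)
    show "isCont (\<lambda>t. real (Suc k) * ?m k t + ?d t - x * ?m (Suc k) t) t" if "t > 0" for t
    proof -
      have "isCont Phi_kernel t" using DERIV_Phi_kernel[OF that] DERIV_isCont by blast
      moreover have "isCont log_deriv_kernel t"
        unfolding log_deriv_kernel_def using that exp_gt_add_one[OF that]
        by (intro continuous_intros) auto
      ultimately show ?thesis by (intro continuous_intros)
    qed
    show "integrable half_line (\<lambda>t. real (Suc k) * ?m k t + ?d t - x * ?m (Suc k) t)"
      by (intro Bochner_Integration.integrable_diff Bochner_Integration.integrable_add
            integrable_mult_right integrable_moment integrable_moment_deriv x)
    show "(?m (Suc k) \<longlongrightarrow> 0) (at_right 0)"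
    proof (rule Lim_null_comparison)
      show "\<forall>\<^sub>F t in at_right 0. norm (?m (Suc k) t) \<le> t ^ Suc k * exp (-(x * t))"
        using eventually_at_right_less[of 0] by eventually_elim (use le in simp)
      have "((\<lambda>t. t ^ Suc k * exp (-(x * t))) \<longlongrightarrow> 0 ^ Suc k * exp (-(x * 0))) (at_right 0)"
        by (intro tendsto_intros)
      then show "((\<lambda>t. t ^ Suc k * exp (-(x * t))) \<longlongrightarrow> 0) (at_right 0)" by simp
    qed
    show "(?m (Suc k) \<longlongrightarrow> 0) at_top"
    proof (rule Lim_null_comparison)
      show "\<forall>\<^sub>F t in at_top. norm (?m (Suc k) t) \<le> t ^ Suc k * exp (-(x * t))"
        using eventually_gt_at_top[of 0] by eventually_elim (use le in simp)
      show "((\<lambda>t. t ^ Suc k * exp (-(x * t))) \<longlongrightarrow> 0) at_top"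
        using x by real_asymp
    qed
  qed
  moreover have "(LINT t|half_line. real (Suc k) * ?m k t + ?d t - x * ?m (Suc k) t) =
      real (Suc k) * moment k x + (LINT t|half_line. ?d t) - x * moment (Suc k) x"
    unfolding moment_def
    by (simp only: Bochner_Integration.integral_diff Bochner_Integration.integral_add
          Bochner_Integration.integrable_add integral_mult_right_zero integrable_mult_right
          integrable_moment integrable_moment_deriv x)
  ultimately show ?thesis by simp
qed

text \<open>Chebyshev's inequality with a single integral. Here c = M_(k+2) / M_(k+1) is the mean of
  t under t^(k+1) g e^(-xt) dt, so the terms with the constant l(c) cancel, while (c - t) (l(t) -
  l(c)) is positive off c because l decreases.\<close>

lemma moment_chebyshev:
  assumes x: "x > 0"
  shows "moment (Suc k) x * (LINT t|half_line. t ^ Suc (Suc k) * (Phi_kernel t * log_deriv_kernel t) * exp (-(x * t)))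
    < moment (Suc (Suc k)) x * (LINT t|half_line. t ^ Suc k * (Phi_kernel t * log_deriv_kernel t) * exp (-(x * t)))"
proof -
  let ?m = "\<lambda>k t. t ^ k * Phi_kernel t * exp (-(x * t))"
  let ?d = "\<lambda>k t. t ^ k * (Phi_kernel t * log_deriv_kernel t) * exp (-(x * t))"
  define a where "a = moment (Suc k) x"
  define b where "b = moment (Suc (Suc k)) x"
  define c where "c = b / a"
  define l where "l = log_deriv_kernel c"
  have ab: "a > 0" "b > 0" using x by (auto simp: a_def b_def moment_pos)
  then have c: "c > 0" "b = c * a" by (auto simp: c_def)
  let ?f = "\<lambda>t. c * ?d (Suc k) t - ?d (Suc (Suc k)) t + l * ?m (Suc (Suc k)) t - l * c * ?m (Suc k) t"
  have eq: "?f t = ?m (Suc k) t * ((c - t) * (log_deriv_kernel t - l))" for t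
    by (simp add: algebra_simps)
  have f: "integrable half_line ?f"
    by (intro Bochner_Integration.integrable_diff Bochner_Integration.integrable_add
          integrable_mult_right integrable_moment integrable_moment_deriv x)
  have "(LINT t|half_line. ?f t) > 0"
  proof (rule integral_half_line_pos[OF f])
    fix t :: real assume t: "t > 0" "t \<noteq> c"
    have "(c - t) * (log_deriv_kernel t - l) > 0"
    proof (cases "t < c")
      case True
      then show ?thesis
        using log_deriv_kernel_strict_antimono[OF t(1) True] by (intro mult_pos_pos) (auto simp: l_def)
    next
      case False
      then have "c < t" using t by simp
      then show ?thesis
        using log_deriv_kernel_strict_antimono[OF c(1)] by (intro mult_neg_neg) (auto simp: l_def)
    qed
    moreover have "?m (Suc k) t > 0" using t Phi_kernel_bounds(1)[OF t(1)] by simp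
    ultimately show "?f t > 0" unfolding eq by (rule mult_pos_pos[rotated])
  next
    show "?f c \<ge> 0" unfolding eq by simp
  qed
  also have "(LINT t|half_line. ?f t) =
      c * (LINT t|half_line. ?d (Suc k) t) - (LINT t|half_line. ?d (Suc (Suc k)) t) + l * b - l * c * a"
    unfolding a_def b_def moment_def
    by (simp only: Bochner_Integration.integral_diff Bochner_Integration.integral_add
          Bochner_Integration.integrable_diff Bochner_Integration.integrable_add
          integral_mult_right_zero integrable_mult_right integrable_moment integrable_moment_deriv x)
  finally have "(LINT t|half_line. ?d (Suc (Suc k)) t) < c * (LINT t|half_line. ?d (Suc k) t)"
    using c by simp
  then have "a * (LINT t|half_line. ?d (Suc (Suc k)) t) < a * (c * (LINT t|half_line. ?d (Suc k) t))"
    using ab by (intro mult_strict_left_mono)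
  then show ?thesis using c unfolding a_def[symmetric] b_def[symmetric] by (simp add: mult_ac)
qed

text \<open>After cross-multiplying, the recurrence replaces (k+1) M_k and (k+2) M_(k+1); the
  products x M_(k+1) M_(k+2) cancel and \<open>moment_chebyshev\<close> is left.\<close>

lemma moment_ratio_strict_decreasing:
  assumes x: "x > 0" and "i < j"
  shows "moment (Suc j) x / (real (Suc j) * moment j x) < moment (Suc i) x / (real (Suc i) * moment i x)"
proof -
  have step: "moment (Suc (Suc k)) x / (real (Suc (Suc k)) * moment (Suc k) x)
      < moment (Suc k) x / (real (Suc k) * moment k x)" for k
  proof -
    let ?D = "\<lambda>k. LINT t|half_line. t ^ k * (Phi_kernel t * log_deriv_kernel t) * exp (-(x * t))"
    have 1: "real (Suc k) * moment k x = x * moment (Suc k) x - ?D (Suc k)"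
      and 2: "real (Suc (Suc k)) * moment (Suc k) x = x * moment (Suc (Suc k)) x - ?D (Suc (Suc k))"
      using moment_recurrence[OF x, of k] moment_recurrence[OF x, of "Suc k"] by linarith+
    have "moment (Suc (Suc k)) x * (real (Suc k) * moment k x)
        < moment (Suc k) x * (real (Suc (Suc k)) * moment (Suc k) x)"
      unfolding 1 2 using moment_chebyshev[OF x, of k] by (simp add: algebra_simps)
    then show ?thesis
      using moment_pos[OF x] by (simp add: divide_less_eq less_divide_eq mult_ac)
  qed
  \<comment> \<open>The signs are flipped because \<open>lift_Suc_mono_less\<close> concerns
    increasing sequences.\<close>
  have "- (moment (Suc i) x / (real (Suc i) * moment i x)) < - (moment (Suc j) x / (real (Suc j) * moment j x))"
    by (rule lift_Suc_mono_less[OF _ \<open>i < j\<close>]) (use step in simp)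
  then show ?thesis by simp
qed

section \<open>Monotonicity, limits and range of Y\<close>

lemma Y_eq_moment:
  "x > 0 \<Longrightarrow> Y m n x = - (moment (m + n + 1) x / (moment m x * moment n x))"
  by (simp only: Y_def higher_deriv_Phi)
     (auto simp: power_add divide_simps split: if_splits)

lemma DERIV_moment_quotient:
  assumes x: "x > 0"
  obtains d where "((\<lambda>x. moment (m + n + 1) x / (moment m x * moment n x)) has_real_derivative d) (at x)" "d > 0"
proof
  let ?N = "m + n + 1"
  define r where "r = (\<lambda>k. moment (Suc k) x / (real (Suc k) * moment k x))"
  note pos = moment_pos[OF x]
  have E: "moment (Suc k) x = real (Suc k) * r k * moment k x" for k
    using pos[of k] by (simp add: r_def)
  let ?d = "(- moment (Suc ?N) x * (moment m x * moment n x) -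
      moment ?N x * (- moment (Suc m) x * moment n x + - moment (Suc n) x * moment m x)) /
      ((moment m x * moment n x) * (moment m x * moment n x))"
  show "((\<lambda>x. moment ?N x / (moment m x * moment n x)) has_real_derivative ?d) (at x)"
    using pos[of m] pos[of n] by (intro DERIV_divide DERIV_mult DERIV_moment x) auto
  \<comment> \<open>Up to the positive factor M_N M_m M_n this is the numerator of the derivative.
    It uses N + 1 = (m + 1) + (n + 1) and that N exceeds both m and n.\<close>
  have "real (Suc ?N) * r ?N < real (Suc m) * r m + real (Suc n) * r n"
  proof -
    have "r ?N < r m" "r ?N < r n"
      unfolding r_def using x by (intro moment_ratio_strict_decreasing; simp)+
    then have "real (Suc m) * r ?N < real (Suc m) * r m" "real (Suc n) * r ?N < real (Suc n) * r n"
      by (intro mult_strict_left_mono; simp)+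
    then show ?thesis by (simp add: algebra_simps)
  qed
  then have "0 < (moment ?N x * moment m x * moment n x) *
      (real (Suc m) * r m + real (Suc n) * r n - real (Suc ?N) * r ?N)"
    using pos by (intro mult_pos_pos) auto
  also have "\<dots> = - moment (Suc ?N) x * (moment m x * moment n x) -
      moment ?N x * (- moment (Suc m) x * moment n x + - moment (Suc n) x * moment m x)"
    unfolding E[of m] E[of n] E[of ?N] by (simp add: algebra_simps)
  finally show "?d > 0" using pos by (intro divide_pos_pos mult_pos_pos) auto
qed

lemma strict_antimono_on_Y: "strict_antimono_on {0<..} (Y m n)"
proof (rule monotone_onI)
  fix x y :: real assume xy: "x \<in> {0<..}" "y \<in> {0<..}" "x < y"
  have "moment (m + n + 1) x / (moment m x * moment n x) < moment (m + n + 1) y / (moment m y * moment n y)"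
  proof (rule DERIV_pos_imp_increasing[OF \<open>x < y\<close>])
    fix z assume "x \<le> z"
    then have "z > 0" using xy by simp
    then show "\<exists>d. ((\<lambda>x. moment (m + n + 1) x / (moment m x * moment n x)) has_real_derivative d) (at z) \<and> d > 0"
      by (rule DERIV_moment_quotient[of z m n]) blast
  qed
  then show "Y m n y < Y m n x" using xy by (simp add: Y_eq_moment)
qed

lemma continuous_on_Y: "continuous_on {0<..} (Y m n)"
proof -
  have "continuous_on {0<..} (\<lambda>x. - (moment (m + n + 1) x / (moment m x * moment n x)))"
  proof (intro continuous_on_minus continuous_at_imp_continuous_on ballI)
    fix x :: real assume "x \<in> {0<..}"
    then have "x > 0" by simp
    then show "isCont (\<lambda>x. moment (m + n + 1) x / (moment m x * moment n x)) x"
      by (rule DERIV_moment_quotient[of x m n]) (rule DERIV_isCont)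
  qed
  then show ?thesis
    by (rule continuous_on_cong[THEN iffD1, rotated -1]) (simp_all add: Y_eq_moment)
qed

text \<open>The powers of x cancel since m + n + 2 = (m + 1) + (n + 1), so scaled moments may
  replace the moments. One factor \<open>a\<close> survives in the denominator; it is the limit of
  g, 1 for x to 0 and 1/2 for x to infinity.\<close>

lemma Y_tendsto:
  assumes lim: "\<And>k. ((\<lambda>x. x ^ Suc k * moment k x) \<longlongrightarrow> a * fact k) F" and "a \<noteq> 0"
    and pos: "\<forall>\<^sub>F x in F. x > 0"
  shows "(Y m n \<longlongrightarrow> - (fact (m + n + 1) / (a * (fact m * fact n)))) F"
proof -
  have "((\<lambda>x. - ((x ^ Suc (m + n + 1) * moment (m + n + 1) x) /
      ((x ^ Suc m * moment m x) * (x ^ Suc n * moment n x)))) \<longlongrightarrow>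
      - ((a * fact (m + n + 1)) / ((a * fact m) * (a * fact n)))) F"
    using \<open>a \<noteq> 0\<close> by (intro tendsto_minus tendsto_divide tendsto_mult[of "\<lambda>x. x ^ Suc m * moment m x"] lim) auto
  moreover have "\<forall>\<^sub>F x in F. - ((x ^ Suc (m + n + 1) * moment (m + n + 1) x) /
      ((x ^ Suc m * moment m x) * (x ^ Suc n * moment n x))) = Y m n x"
    using pos
  proof eventually_elim
    case (elim x)
    have "(x ^ Suc (m + n + 1) * moment (m + n + 1) x) /
        ((x ^ Suc m * moment m x) * (x ^ Suc n * moment n x)) =
        (x ^ Suc (m + n + 1) * moment (m + n + 1) x) / (x ^ Suc (m + n + 1) * (moment m x * moment n x))"
      by (simp add: power_add mult_ac)
    then show ?case using elim by (simp add: Y_eq_moment)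
  qed
  ultimately have "(Y m n \<longlongrightarrow> - ((a * fact (m + n + 1)) / ((a * fact m) * (a * fact n)))) F"
    by (rule Lim_transform_eventually)
  then show ?thesis using \<open>a \<noteq> 0\<close> by (simp add: mult_ac)
qed

text \<open>The values at x/2 and x + 1 separate f x from the limits and so make the bounds strict;
  the intermediate value theorem gives surjectivity.\<close>

lemma strict_antimono_on_image_half_line:
  fixes f :: "real \<Rightarrow> real"
  assumes anti: "strict_antimono_on {0<..} f" and cont: "continuous_on {0<..} f"
    and U: "(f \<longlongrightarrow> U) (at_right 0)" and L: "(f \<longlongrightarrow> L) at_top"
  shows "f ` {0<..} = {L<..<U}"
proof safe
  fix x :: real assume x: "x > 0"
  have less: "f b < f a" if "0 < a" "a < b" for a b
    using monotone_onD[OF anti, of a b] that by simp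
  have "\<forall>\<^sub>F y in at_right 0. f (x / 2) \<le> f y"
    using eventually_at_right_real[of 0 "x / 2"] x
    by (auto elim!: eventually_mono intro!: less_imp_le less)
  then have "f (x / 2) \<le> U" using U by (intro tendsto_lowerbound) auto
  moreover have "\<forall>\<^sub>F y in at_top. f y \<le> f (x + 1)"
    using eventually_gt_at_top[of "x + 1"] by eventually_elim (use x in \<open>auto intro!: less_imp_le less\<close>)
  then have "L \<le> f (x + 1)" using L by (intro tendsto_upperbound) auto
  ultimately show "f x \<in> {L<..<U}" using less[of "x / 2" x] less[of x "x + 1"] x by auto
next
  fix v assume v: "v \<in> {L<..<U}"
  have "\<forall>\<^sub>F y in at_right 0. v < f y \<and> y > 0"
    using order_tendstoD(1)[OF U, of v] v eventually_at_right_less[of 0]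
    by (auto intro: eventually_conj)
  then obtain a where a: "v < f a" "a > 0"
    by (metis (mono_tags, lifting) eventually_happens' trivial_limit_at_right_real)
  have "\<forall>\<^sub>F y in at_top. f y < v \<and> y > a"
    using order_tendstoD(2)[OF L, of v] v eventually_gt_at_top[of a] by (auto intro: eventually_conj)
  then obtain b where b: "f b < v" "b > a"
    by (metis (mono_tags, lifting) eventually_happens' trivial_limit_at_top_linorder)
  have "continuous_on {a..b} f" using a by (intro continuous_on_subset[OF cont]) auto
  then obtain x where "a \<le> x" "f x = v"
    using IVT2'[of f b v a] a b by auto
  then show "v \<in> f ` {0<..}" using a by auto
qed

theorem theorem1:
  fixes m n :: nat
  shows "let L = - (2 * fact (m + n + 1) / (fact m * fact n)) :: real;
             U = - (fact (m + n + 1) / (fact m * fact n)) :: real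
         in strict_antimono_on {0<..} (Y m n)
          \<and> Y m n ` {0<..} = {L<..<U}
          \<and> (\<forall>x>0. L < Y m n x \<and> Y m n x < U)
          \<and> (\<forall>c>L. \<not> (\<forall>x>0. c < Y m n x))
          \<and> (\<forall>c<U. \<not> (\<forall>x>0. Y m n x < c))"
proof -
  define L U :: real where "L = - (2 * fact (m + n + 1) / (fact m * fact n))"
    and "U = - (fact (m + n + 1) / (fact m * fact n))"
  have "(Y m n \<longlongrightarrow> U) (at_right 0)"
    using Y_tendsto[of 1 "at_right 0" m n] power_times_moment_tendsto_at_0
    by (simp add: U_def eventually_at_right_less)
  moreover have "(Y m n \<longlongrightarrow> L) at_top"
    using Y_tendsto[of "1 / 2" at_top m n] power_times_moment_tendsto_at_top
    by (simp add: L_def eventually_gt_at_top mult.commute)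
  ultimately have image: "Y m n ` {0<..} = {L<..<U}"
    by (intro strict_antimono_on_image_half_line strict_antimono_on_Y continuous_on_Y)
  then have bounds: "L < Y m n x \<and> Y m n x < U" if "x > 0" for x
    using that by (metis greaterThanLessThan_iff greaterThan_iff imageI)
  have attained: "\<exists>x>0. Y m n x = v" if "L < v" "v < U" for v
    using that image by (metis greaterThanLessThan_iff greaterThan_iff imageE)
  \<comment> \<open>This makes the interval nonempty, as needed to find attained values near its
    ends.\<close>
  have "L = 2 * U" "U < 0" by (simp_all only: L_def U_def) auto
  then have "L < U" by simp
  have "\<not> (\<forall>x>0. c < Y m n x)" if c: "c > L" for c
  proof -
    \<comment> \<open>The minimum with U covers c \<ge> U too: v then lies in the range and is still
      below c.\<close>
    obtain v where v: "L < v" "v < min c U" using dense[of L "min c U"] \<open>L < U\<close> c by auto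
    then show ?thesis using attained[of v] by force
  qed
  moreover have "\<not> (\<forall>x>0. Y m n x < c)" if c: "c < U" for c
  proof -
    obtain v where v: "max c L < v" "v < U" using dense[of "max c L" U] \<open>L < U\<close> c by auto
    then show ?thesis using attained[of v] by force
  qed
  ultimately show ?thesis
    using strict_antimono_on_Y image bounds unfolding Let_def L_def U_def by blast
qed

end
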